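(* Let $n,p,s$ be positive integers with $s\le p$ and $s\ge 2\sqrt{n}+1$, and let $\delta\in(0,1)$. Let $\Phi\in\mathbb{R}^{n\times p}$ be a real matrix with columns $u_1,\ldots,u_p\in\mathbb{R}^n$ of unit Euclidean norm, $\|u_i\|_2=1$ for all $1\le i\le p$, and suppose that $\Phi$ satisfies the $(s,\delta)$-Restricted Isometry Property. Let $\mathbb{G}$ be the complete graph on the node set $[p]=\{1,2,\ldots,p\}$ whose edges are colored with three colors as follows: for $1\le i\neq j\le p$, the edge $(i,j)$ is colored white if $|\langle u_i,u_j\rangle|\le \frac{1}{2\sqrt{n}}$, blue if $\langle u_i,u_j\rangle>\frac{1}{2\sqrt{n}}$, and red if $\langle u_i,u_j\rangle<-\frac{1}{2\sqrt{n}}$. Then $\mathbb{G}$ is $R(2n,\,2\sqrt{n}+1,\,2\sqrt{n}+1;\,3)$ Ramsey with respect to the colors (white, blue, red); that is, every white clique has at most $2n$ nodes, every blue clique has at most $2\sqrt{n}+1$ nodes, and every red clique has at most $2\sqrt{n}+1$ nodes.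
   Context: A real $n\times p$ matrix $\Phi$ with unit norm column vectors satisfies the $(s,\delta)$-Restricted Isometry Property (RIP), for $s\le p$ and $\delta\in(0,1)$, if $\big|\|\Phi x\|_2^2-1\big|\le\delta$ for every $x\in\mathbb{R}^p$ with $\|x\|_2=1$ that is $s$-sparse, i.e., has at most $s$ non-zero coordinates. Here $\langle\cdot,\cdot\rangle$ is the standard inner product on $\mathbb{R}^n$ and $\|\cdot\|_2$ is the Euclidean norm. A complete graph $K_p$ on $p$ nodes whose $p(p-1)/2$ edges are colored using $q$ colors is called $R(m_1,\ldots,m_q;q)$ Ramsey if, for every $1\le r\le q$, the largest monochromatic clique with respect to color $r$ (a subset of nodes such that all edges between distinct nodes of the subset have color $r$) has at most $m_r$ nodes. The numbers $m_r$ are not required to be integers. *)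

theory Defs
  imports "HOL-Analysis.Analysis" "HOL-Library.Ramsey"
begin

definition sparse_vec :: "nat \<Rightarrow> real ^ 'p \<Rightarrow> bool" where
  "sparse_vec s x \<longleftrightarrow> card {j. x $ j \<noteq> 0} \<le> s"

text \<open>
  Only the defining inequality. The side conditions under which the property is considered
  (unit norm columns, \<open>s \<le> p\<close>, \<open>0 < \<delta> < 1\<close>) are stated separately where it is used.
\<close>
definition RIP :: "nat \<Rightarrow> real \<Rightarrow> real ^ 'p ^ 'n \<Rightarrow> bool" where
  "RIP s \<delta> \<Phi> \<longleftrightarrow>
     (\<forall>x. norm x = 1 \<longrightarrow> sparse_vec s x \<longrightarrow> \<bar>(norm (\<Phi> *v x))\<^sup>2 - 1\<bar> \<le> \<delta>)"

text \<open>
  The edges of the complete graph on \<open>V\<close> are the two-element subsets \<open>[V]\<^bsup>2\<^esup>\<close>. The empty set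
  and singletons are monochromatic cliques of every color.
\<close>
definition mono_clique :: "'v set \<Rightarrow> ('v set \<Rightarrow> nat) \<Rightarrow> nat \<Rightarrow> 'v set \<Rightarrow> bool" where
  "mono_clique V col r C \<longleftrightarrow> C \<subseteq> V \<and> (\<forall>e \<in> [C]\<^bsup>2\<^esup>. col e = r)"

text \<open>
  \<open>ramsey_colored V col ms q\<close>: the complete graph on \<open>V\<close> with edge coloring \<open>col\<close> is
  \<open>R(m\<^sub>1,\<dots>,m\<^sub>q;q)\<close> Ramsey. Colors are \<open>1,\<dots>,q\<close>, while list indices start at 0.
\<close>
definition ramsey_colored ::
    "'v set \<Rightarrow> ('v set \<Rightarrow> nat) \<Rightarrow> real list \<Rightarrow> nat \<Rightarrow> bool" where
  "ramsey_colored V col ms q \<longleftrightarrow>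
     finite V \<and> length ms = q \<and> col \<in> [V]\<^bsup>2\<^esup> \<rightarrow> {1..q} \<and>
     (\<forall>r\<in>{1..q}. \<forall>C. mono_clique V col r C \<longrightarrow> real (card C) \<le> ms ! (r - 1))"

abbreviation (input) white :: nat where "white \<equiv> 1"
abbreviation (input) blue :: nat where "blue \<equiv> 2"
abbreviation (input) red :: nat where "red \<equiv> 3"

end

theory Submission
  imports Defs
begin

text \<open>
  Each colour class is bounded by testing the Gram matrix of a monochromatic clique.

  A white clique is a set of \<open>N\<close> nearly orthogonal unit vectors. Their Gram matrix has trace \<open>N\<close>
  and rank at most \<open>n\<close>, so its squared Frobenius norm is at least \<open>N\<^sup>2 / n\<close>
  (\<open>welch_bound\<close>). Small off-diagonal entries keep that norm below \<open>N + N (N - 1) / (4 n)\<close>,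
  and comparing the two gives \<open>3 N \<le> 4 n - 1\<close>.

  For blue and red cliques the test vector is the all-ones vector. The squared norm of
  \<open>\<Sum>i\<in>C. u i\<close> is the number of vectors plus the sum of the off-diagonal Gram entries. When these
  entries have a common sign and absolute value above \<open>1 / (2 \<surd>n)\<close>, and \<open>C\<close> has at least
  \<open>2 \<surd>n + 1\<close> nodes, the off-diagonal part outweighs the diagonal. In the blue case the
  indicator vector of \<open>C\<close> is then stretched by a factor at least \<open>\<surd>2\<close>, against the restricted
  isometry property (\<open>RIP_norm_sum_columns\<close>); a clique larger than \<open>s\<close> is first cut down to
  exactly \<open>s\<close> nodes, and \<open>s \<ge> 2 \<surd>n + 1\<close> leaves enough of them. In the red case a squared norm
  would be negative.
\<close>

lemma norm_sum_unit_vectors: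
  fixes u :: "'a \<Rightarrow> 'b::real_inner"
  assumes "finite C" and "\<And>i. i \<in> C \<Longrightarrow> norm (u i) = 1"
  shows "(norm (\<Sum>i\<in>C. u i))\<^sup>2 = real (card C) + (\<Sum>i\<in>C. \<Sum>j\<in>C - {i}. u i \<bullet> u j)"
proof -
  have "(norm (\<Sum>i\<in>C. u i))\<^sup>2 = (\<Sum>i\<in>C. \<Sum>j\<in>C. u i \<bullet> u j)"
    by (simp add: power2_norm_eq_inner inner_sum_left inner_sum_right) (rule sum.swap)
  also have "\<dots> = (\<Sum>i\<in>C. 1 + (\<Sum>j\<in>C - {i}. u i \<bullet> u j))"
  proof (rule sum.cong[OF refl])
    fix i assume "i \<in> C"
    then show "(\<Sum>j\<in>C. u i \<bullet> u j) = 1 + (\<Sum>j\<in>C - {i}. u i \<bullet> u j)"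
      using assms by (simp add: sum.remove[of C i] dot_square_norm)
  qed
  finally show ?thesis by (simp add: sum.distrib)
qed

text \<open>
  The sum of the squared Gram entries is the squared Frobenius norm of the \<open>n \<times> n\<close> matrix
  \<open>\<Sum>i\<in>C. u\<^sub>i u\<^sub>i\<^sup>T\<close>. Discarding its off-diagonal entries and applying the Cauchy--Schwarz inequality
  to its diagonal, which sums to \<open>card C\<close>, gives the bound.
\<close>
lemma welch_bound:
  fixes u :: "'a \<Rightarrow> real ^ 'n"
  assumes "\<And>i. i \<in> C \<Longrightarrow> norm (u i) = 1"
  shows "(real (card C))\<^sup>2 \<le> real CARD('n) * (\<Sum>i\<in>C. \<Sum>j\<in>C. (u i \<bullet> u j)\<^sup>2)"
proof -
  define S where "S a b = (\<Sum>i\<in>C. u i $ a * u i $ b)" for a b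
  have trace: "(\<Sum>a\<in>UNIV. S a a) = real (card C)"
  proof -
    have "(\<Sum>a\<in>UNIV. S a a) = (\<Sum>i\<in>C. u i \<bullet> u i)"
      unfolding S_def inner_vec_def by (subst sum.swap) simp
    also have "\<dots> = real (card C)" using assms by (simp add: dot_square_norm)
    finally show ?thesis .
  qed
  have frobenius: "(\<Sum>i\<in>C. \<Sum>j\<in>C. (u i \<bullet> u j)\<^sup>2) = (\<Sum>a\<in>UNIV. \<Sum>b\<in>UNIV. (S a b)\<^sup>2)"
  proof -
    have "(\<Sum>i\<in>C. \<Sum>j\<in>C. (u i \<bullet> u j)\<^sup>2)
        = (\<Sum>i\<in>C. \<Sum>j\<in>C. \<Sum>a\<in>UNIV. \<Sum>b\<in>UNIV. (u i $ a * u j $ a) * (u i $ b * u j $ b))"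
      by (simp add: inner_vec_def power2_eq_square sum_product)
    also have "\<dots> = (\<Sum>i\<in>C. \<Sum>a\<in>UNIV. \<Sum>j\<in>C. \<Sum>b\<in>UNIV. (u i $ a * u j $ a) * (u i $ b * u j $ b))"
      by (intro sum.cong refl sum.swap)
    also have "\<dots> = (\<Sum>i\<in>C. \<Sum>a\<in>UNIV. \<Sum>b\<in>UNIV. \<Sum>j\<in>C. (u i $ a * u j $ a) * (u i $ b * u j $ b))"
      by (intro sum.cong refl sum.swap)
    also have "\<dots> = (\<Sum>a\<in>UNIV. \<Sum>i\<in>C. \<Sum>b\<in>UNIV. \<Sum>j\<in>C. (u i $ a * u j $ a) * (u i $ b * u j $ b))"
      by (rule sum.swap)
    also have "\<dots> = (\<Sum>a\<in>UNIV. \<Sum>b\<in>UNIV. \<Sum>i\<in>C. \<Sum>j\<in>C. (u i $ a * u j $ a) * (u i $ b * u j $ b))"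
      by (intro sum.cong refl sum.swap)
    also have "\<dots> = (\<Sum>a\<in>UNIV. \<Sum>b\<in>UNIV. (S a b)\<^sup>2)"
      by (simp add: S_def power2_eq_square sum_product mult_ac)
    finally show ?thesis .
  qed
  have "(real (card C))\<^sup>2 = (\<Sum>a\<in>UNIV. 1 * S a a)\<^sup>2" by (simp add: trace)
  also have "\<dots> \<le> real CARD('n) * (\<Sum>a\<in>UNIV. (S a a)\<^sup>2)"
    using Cauchy_Schwarz_ineq_sum[of "\<lambda>_. 1" "\<lambda>a. S a a" UNIV] by simp
  also have "\<dots> \<le> real CARD('n) * (\<Sum>a\<in>UNIV. \<Sum>b\<in>UNIV. (S a b)\<^sup>2)"
    by (intro mult_left_mono sum_mono member_le_sum) auto
  finally show ?thesis by (simp add: frobenius)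
qed

text \<open>
  The threshold on the inner products is half the scale \<open>1 / \<surd>n\<close> below which the Welch bound stops
  limiting the number of vectors; this is why a bound linear in the dimension survives.
\<close>
lemma card_nearly_orthogonal:
  fixes u :: "'a \<Rightarrow> real ^ 'n"
  assumes C: "finite C" and unit: "\<And>i. i \<in> C \<Longrightarrow> norm (u i) = 1"
    and small: "\<And>i j. i \<in> C \<Longrightarrow> j \<in> C \<Longrightarrow> i \<noteq> j \<Longrightarrow>
      \<bar>u i \<bullet> u j\<bar> \<le> 1 / (2 * sqrt (real CARD('n)))"
  shows "3 * real (card C) \<le> 4 * real CARD('n)"
proof (cases "C = {}")
  case False
  define N n where "N = real (card C)" and "n = real CARD('n)"
  have n: "n > 0" by (simp add: n_def)
  have N: "N \<ge> 1" using C False by (simp add: N_def Suc_le_eq card_gt_0_iff)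
  have row: "(\<Sum>j\<in>C. (u i \<bullet> u j)\<^sup>2) \<le> 1 + (N - 1) / (4 * n)" if i: "i \<in> C" for i
  proof -
    have "(u i \<bullet> u j)\<^sup>2 \<le> 1 / (4 * n)" if "j \<in> C - {i}" for j
    proof -
      have "\<bar>u i \<bullet> u j\<bar>\<^sup>2 \<le> (1 / (2 * sqrt n))\<^sup>2"
        using small[of i j] i that by (intro power_mono) (auto simp: n_def)
      then show ?thesis using n by (simp add: power_divide power_mult_distrib)
    qed
    then have "(\<Sum>j\<in>C - {i}. (u i \<bullet> u j)\<^sup>2) \<le> real (card (C - {i})) * (1 / (4 * n))"
      by (rule sum_bounded_above)
    moreover have "real (card (C - {i})) = N - 1"
      using C i N by (simp add: N_def of_nat_diff)
    ultimately show ?thesis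
      using C i unit by (simp add: sum.remove[of C i] dot_square_norm)
  qed
  have "N * N \<le> n * (\<Sum>i\<in>C. \<Sum>j\<in>C. (u i \<bullet> u j)\<^sup>2)"
    using welch_bound[of C u] unit by (simp add: N_def n_def power2_eq_square)
  also have "\<dots> \<le> n * (N * (1 + (N - 1) / (4 * n)))"
    using sum_bounded_above[of C, OF row] n by (intro mult_left_mono) (auto simp: N_def)
  also have "\<dots> = N * (n + (N - 1) / 4)" using n by (simp add: field_simps)
  finally have "N \<le> n + (N - 1) / 4" using N by simp
  then show ?thesis unfolding N_def n_def by argo
qed simp

text \<open>
  The restricted isometry property tested on the normalised indicator vector of \<open>C\<close>, whose image
  is the sum of the columns indexed by \<open>C\<close> divided by \<open>\<surd>(card C)\<close>.
\<close>
lemma RIP_norm_sum_columns: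
  fixes \<Phi> :: "real ^ 'p ^ 'n"
  assumes rip: "RIP s \<delta> \<Phi>" and "card C \<le> s" and "C \<noteq> {}"
  shows "(norm (\<Sum>j\<in>C. column j \<Phi>))\<^sup>2 \<le> (1 + \<delta>) * real (card C)"
proof -
  define k where "k = real (card C)"
  have k: "k > 0" using \<open>C \<noteq> {}\<close> by (simp add: k_def card_gt_0_iff)
  define x :: "real ^ 'p" where "x = (\<chi> j. if j \<in> C then 1 / sqrt k else 0)"
  have "(norm x)\<^sup>2 = (\<Sum>j\<in>UNIV. if j \<in> C then 1 / k else 0)"
    unfolding power2_norm_eq_inner inner_vec_def x_def
    using k by (intro sum.cong) auto
  also have "\<dots> = 1" using k \<open>C \<noteq> {}\<close> by (simp add: sum.If_cases k_def)
  finally have "norm x = 1" by (simp add: power2_eq_1_iff) (smt (verit) norm_ge_zero)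
  moreover have "{j. x $ j \<noteq> 0} = C" using k by (auto simp: x_def)
  ultimately have "\<bar>(norm (\<Phi> *v x))\<^sup>2 - 1\<bar> \<le> \<delta>"
    using rip \<open>card C \<le> s\<close> by (simp add: RIP_def sparse_vec_def)
  then have "(norm (\<Phi> *v x))\<^sup>2 \<le> 1 + \<delta>" by linarith
  moreover have "\<Phi> *v x = (1 / sqrt k) *\<^sub>R (\<Sum>j\<in>C. column j \<Phi>)"
  proof -
    have "\<Phi> *v x = (\<Sum>j\<in>UNIV. if j \<in> C then (1 / sqrt k) *\<^sub>R column j \<Phi> else 0)"
      unfolding matrix_mult_sum
      by (intro sum.cong) (auto simp: x_def scalar_mult_eq_scaleR)
    then show ?thesis by (simp add: sum.If_cases scaleR_sum_right)
  qed
  ultimately have "(norm (\<Sum>j\<in>C. column j \<Phi>))\<^sup>2 / k \<le> 1 + \<delta>"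
    using k by (simp add: power_mult_distrib power_divide)
  then show ?thesis using k by (simp add: field_simps k_def)
qed

lemma sum_off_diagonal_ge:
  fixes f :: "'a \<Rightarrow> 'a \<Rightarrow> real"
  assumes "finite C" and "\<And>i j. i \<in> C \<Longrightarrow> j \<in> C \<Longrightarrow> i \<noteq> j \<Longrightarrow> t \<le> f i j"
  shows "real (card C) * (real (card C) - 1) * t \<le> (\<Sum>i\<in>C. \<Sum>j\<in>C - {i}. f i j)"
proof -
  have "(real (card C) - 1) * t \<le> (\<Sum>j\<in>C - {i}. f i j)" if "i \<in> C" for i
  proof -
    have "real (card (C - {i})) * t \<le> (\<Sum>j\<in>C - {i}. f i j)"
      using assms that by (intro sum_bounded_below) auto
    moreover have "card C \<ge> 1" using assms(1) that by (auto simp: Suc_le_eq card_gt_0_iff)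
    ultimately show ?thesis using assms(1) that by (simp add: of_nat_diff)
  qed
  from sum_bounded_below[of C, OF this] show ?thesis by (simp add: mult_ac)
qed

text \<open>
  With \<open>k\<close> columns, \<open>k \<ge> 1 / t + 1\<close>, each row of the Gram matrix has off-diagonal sum at least
  \<open>(k - 1) t \<ge> 1\<close>, which doubles the squared norm of the sum of the columns. The restricted
  isometry property sees only \<open>s\<close> columns at a time, so a large \<open>C\<close> is replaced by a subset
  of size \<open>min (card C) s\<close>, still at least \<open>1 / t + 1\<close>.
\<close>
lemma card_positively_correlated:
  fixes \<Phi> :: "real ^ 'p ^ 'n"
  assumes rip: "RIP s \<delta> \<Phi>" and "\<delta> < 1" and "t > 0" and s: "real s \<ge> 1 / t + 1"
    and unit: "\<And>i. i \<in> C \<Longrightarrow> norm (column i \<Phi>) = 1"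
    and large: "\<And>i j. i \<in> C \<Longrightarrow> j \<in> C \<Longrightarrow> i \<noteq> j \<Longrightarrow> t \<le> column i \<Phi> \<bullet> column j \<Phi>"
  shows "real (card C) \<le> 1 / t + 1"
proof (rule ccontr)
  assume "\<not> ?thesis"
  then have many: "real (min (card C) s) \<ge> 1 / t + 1" using s by (simp add: min_def)
  obtain D where D: "D \<subseteq> C" "card D = min (card C) s"
    using obtain_subset_with_card_n[of "min (card C) s" C] by auto
  define k where "k = real (card D)"
  have k: "k \<ge> 1 / t + 1" using many D by (simp add: k_def)
  then have "k > 0" using \<open>t > 0\<close> by (smt (verit) zero_less_divide_1_iff)
  have "k * 1 \<le> k * ((k - 1) * t)"
    using k \<open>k > 0\<close> \<open>t > 0\<close> by (intro mult_left_mono) (simp_all add: field_simps)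
  also have "\<dots> \<le> (\<Sum>i\<in>D. \<Sum>j\<in>D - {i}. column i \<Phi> \<bullet> column j \<Phi>)"
    using sum_off_diagonal_ge[of D t "\<lambda>i j. column i \<Phi> \<bullet> column j \<Phi>"] large D
    by (auto simp: k_def mult.assoc)
  also have "\<dots> = (norm (\<Sum>i\<in>D. column i \<Phi>))\<^sup>2 - k"
    using norm_sum_unit_vectors[of D "\<lambda>i. column i \<Phi>"] unit subsetD[OF D(1)]
    by (simp add: k_def)
  also have "\<dots> \<le> \<delta> * k"
  proof -
    have "D \<noteq> {}" using \<open>k > 0\<close> by (auto simp: k_def)
    then show ?thesis
      using RIP_norm_sum_columns[OF rip, of D] D by (simp add: k_def algebra_simps)
  qed
  finally show False using \<open>k > 0\<close> \<open>\<delta> < 1\<close> by simp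
qed

text \<open>
  The squared norm of \<open>\<Sum>i\<in>C. u i\<close> is at most \<open>k - k (k - 1) t\<close> for \<open>k = card C\<close>, and it
  cannot be negative.
\<close>
lemma card_negatively_correlated:
  fixes u :: "'a \<Rightarrow> 'b::real_inner"
  assumes "finite C" and "t > 0" and unit: "\<And>i. i \<in> C \<Longrightarrow> norm (u i) = 1"
    and large: "\<And>i j. i \<in> C \<Longrightarrow> j \<in> C \<Longrightarrow> i \<noteq> j \<Longrightarrow> u i \<bullet> u j \<le> - t"
  shows "real (card C) \<le> 1 / t + 1"
proof (cases "C = {}")
  case True
  then show ?thesis using \<open>t > 0\<close> by simp
next
  case False
  define k where "k = real (card C)"
  have k: "k > 0" using \<open>finite C\<close> False by (simp add: k_def card_gt_0_iff)
  have "k * ((k - 1) * t) \<le> - (\<Sum>i\<in>C. \<Sum>j\<in>C - {i}. u i \<bullet> u j)"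
    using sum_off_diagonal_ge[of C t "\<lambda>i j. - (u i \<bullet> u j)"] \<open>finite C\<close> large
    by (force simp: k_def mult.assoc sum_negf)
  also have "\<dots> = k * 1 - (norm (\<Sum>i\<in>C. u i))\<^sup>2"
    using norm_sum_unit_vectors[of C u] \<open>finite C\<close> unit by (simp add: k_def)
  also have "\<dots> \<le> k * 1" by simp
  finally have "(k - 1) * t \<le> 1" using k by simp
  then show ?thesis using \<open>t > 0\<close> by (simp add: k_def field_simps)
qed

lemma mono_cliqueD:
  assumes "mono_clique V col r C" and "i \<in> C" and "j \<in> C" and "i \<noteq> j"
  shows "col {i, j} = r"
  using assms by (auto simp: mono_clique_def)

theorem theorem2p1:
  fixes \<Phi> :: "real ^ 'p ^ 'n" and u :: "'p \<Rightarrow> real ^ 'n"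
    and n p s :: nat and \<delta> :: real
    and col :: "'p set \<Rightarrow> nat"
  assumes n: "n = CARD('n)" and p: "p = CARD('p)"
    and s: "0 < s" "s \<le> p" "real s \<ge> 2 * sqrt (real n) + 1"
    and \<delta>: "0 < \<delta>" "\<delta> < 1"
    and u: "\<And>i. u i = column i \<Phi>"
    and unit: "\<And>i. norm (u i) = 1"
    and rip: "RIP s \<delta> \<Phi>"
    and col_white: "\<And>i j. i \<noteq> j \<Longrightarrow> \<bar>u i \<bullet> u j\<bar> \<le> 1 / (2 * sqrt (real n)) \<Longrightarrow> col {i, j} = white"
    and col_blue: "\<And>i j. i \<noteq> j \<Longrightarrow> u i \<bullet> u j > 1 / (2 * sqrt (real n)) \<Longrightarrow> col {i, j} = blue"
    and col_red: "\<And>i j. i \<noteq> j \<Longrightarrow> u i \<bullet> u j < - (1 / (2 * sqrt (real n))) \<Longrightarrow> col {i, j} = red"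
  shows "ramsey_colored (UNIV :: 'p set) col
           [2 * real n, 2 * sqrt (real n) + 1, 2 * sqrt (real n) + 1] 3"
proof -
  define t where "t = 1 / (2 * sqrt (real n))"
  have "n > 0" using n by simp
  then have t: "t > 0" "1 / t = 2 * sqrt (real n)" by (simp_all add: t_def)
  note cols = col_white[folded t_def] col_blue[folded t_def] col_red[folded t_def]
  \<comment> \<open>The three conditions on an inner product are exhaustive and the colours are distinct, so each
    colour determines its condition.\<close>
  have white: "\<bar>u i \<bullet> u j\<bar> \<le> t" if "i \<noteq> j" "col {i, j} = white" for i j
    using cols(2,3)[of i j] that by fastforce
  have blue: "t \<le> u i \<bullet> u j" if "i \<noteq> j" "col {i, j} = blue" for i j
    using cols(1,3)[of i j] that by fastforce
  have red: "u i \<bullet> u j \<le> - t" if "i \<noteq> j" "col {i, j} = red" for i j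
    using cols(1,2)[of i j] that by fastforce
  have colours: "col e \<in> {1..3}" if e: "e \<in> [UNIV :: 'p set]\<^bsup>2\<^esup>" for e
  proof -
    obtain i j where ij: "e = {i, j}" "i \<noteq> j"
      using e by (auto simp: nsets_2_eq)
    consider "\<bar>u i \<bullet> u j\<bar> \<le> t" | "t < u i \<bullet> u j" | "u i \<bullet> u j < - t" by linarith
    then show ?thesis using cols[OF ij(2)] ij(1) by cases auto
  qed
  have white_clique: "real (card C) \<le> 2 * real n" if C: "mono_clique UNIV col white C" for C
  proof -
    have "3 * real (card C) \<le> 4 * real CARD('n)"
      using unit white mono_cliqueD[OF C]
      by (intro card_nearly_orthogonal[of C u]) (auto simp: t_def n)
    then show ?thesis by (simp add: n)
  qed
  have blue_clique: "real (card C) \<le> 2 * sqrt (real n) + 1"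
    if C: "mono_clique UNIV col blue C" for C
    unfolding t(2)[symmetric]
    using s(3) unit blue mono_cliqueD[OF C] \<delta>(2) t
    by (intro card_positively_correlated[OF rip]) (auto simp flip: u)
  have red_clique: "real (card C) \<le> 2 * sqrt (real n) + 1"
    if C: "mono_clique UNIV col red C" for C
    unfolding t(2)[symmetric]
    using unit red mono_cliqueD[OF C] t(1)
    by (intro card_negatively_correlated[of C t u]) auto
  have "{1..3} = {white, blue, red}" by auto
  then show ?thesis
    unfolding ramsey_colored_def
    using colours white_clique blue_clique red_clique by auto
qed

end
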